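(* Let $n\ge 1$, let $x_1,\dots,x_n$ be indeterminates and put $s_i:=e_i(x_1,\dots,x_n)$ for $0\le i\le n$, $s_i:=0$ for $i<0$ or $i>n$. Let $A=(s_{j-i})_{i,j\ge1}$. Let $0\le r\le c\le n$, and let ${\boldsymbol\alpha}=(\alpha_1<\dots<\alpha_r)$, ${\boldsymbol\beta}=(\beta_1<\dots<\beta_c)$ be strictly increasing sequences of positive integers with $\alpha_i\ge\beta_i$ for $i=1,\dots,r$. For $k\ge0$ let $D^k_{{\boldsymbol\alpha},{\boldsymbol\beta}}$ be the leading $k\times k$ submatrix of the matrix obtained from $A$ by deleting rows $\alpha_1,\dots,\alpha_r$ and columns $\beta_1,\dots,\beta_c$ (with $\det D^0_{{\boldsymbol\alpha},{\boldsymbol\beta}}=1$). Let $b=\binom{n}{c-r}$ and define polynomials $Q_0,\dots,Q_b$ in $x_1,\dots,x_n$ by $$\sum_{k=0}^b Q_{b-k}\,t^k=\prod_{\sigma\subseteq[n],\ |\sigma|=c-r}\Big(t-\prod_{i\in\sigma}x_i\Big).$$ Then $$\sum_{k=0}^b Q_{b-k}\det\big(D^{k+j}_{{\boldsymbol\alpha},{\boldsymbol\beta}}\big)=0$$ for all integers $j\ge\max(0,\alpha_r-r,\beta_c-c)$ (terms involving an empty sequence omitted from the maximum).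
   Context: $[n]=\{1,\dots,n\}$; $e_i$ denotes the $i$-th elementary symmetric polynomial. *)

theory Defs
  imports
    "HOL-Library.Poly_Mapping"
    "HOL-Library.Infinite_Set"
    "HOL-Computational_Algebra.Polynomial"
    "Jordan_Normal_Form.Determinant"
begin

text \<open>
  Polynomials in the indeterminates \<open>x\<^sub>i\<close> (\<open>i :: nat\<close>) over a commutative ring
  are finitely supported maps from exponent vectors to coefficients; the library's ring
  structure on \<open>\<Rightarrow>\<^sub>0\<close> is convolution.
\<close>

type_synonym 'a mpolynomial = "(nat \<Rightarrow>\<^sub>0 nat) \<Rightarrow>\<^sub>0 'a"

definition indet :: "nat \<Rightarrow> 'a::comm_ring_1 mpolynomial" where
  "indet i = Poly_Mapping.single (Poly_Mapping.single i 1) 1"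

definition elem_sym :: "nat \<Rightarrow> (nat \<Rightarrow> 'a::comm_ring_1) \<Rightarrow> nat \<Rightarrow> 'a" where
  "elem_sym n x i = (\<Sum>\<sigma> | \<sigma> \<subseteq> {1..n} \<and> card \<sigma> = i. \<Prod>l\<in>\<sigma>. x l)"

definition s_sym :: "nat \<Rightarrow> (nat \<Rightarrow> 'a::comm_ring_1) \<Rightarrow> int \<Rightarrow> 'a" where
  "s_sym n x i = (if 0 \<le> i \<and> i \<le> int n then elem_sym n x (nat i) else 0)"

text \<open>The infinite matrix, with rows and columns indexed by the positive integers.\<close>

definition A_mat :: "nat \<Rightarrow> (nat \<Rightarrow> 'a::comm_ring_1) \<Rightarrow> nat \<Rightarrow> nat \<Rightarrow> 'a" where
  "A_mat n x i j = s_sym n x (int j - int i)"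

text \<open>
  Only the values \<open>\<alpha> 1, \<dots>, \<alpha> r\<close> and \<open>\<beta> 1, \<dots>, \<beta> c\<close> matter.
  Matrices of type \<open>mat\<close> and \<open>enumerate\<close> both count from 0, so \<open>enumerate S i\<close>
  is the label of the \<open>(i+1)\<close>-st remaining row or column.
\<close>

definition D_mat ::
  "nat \<Rightarrow> (nat \<Rightarrow> 'a::comm_ring_1) \<Rightarrow> nat \<Rightarrow> (nat \<Rightarrow> nat) \<Rightarrow> nat \<Rightarrow> (nat \<Rightarrow> nat) \<Rightarrow> nat \<Rightarrow> 'a mat"
  where
  "D_mat n x r \<alpha> c \<beta> k =
     mat k k (\<lambda>(i, j). A_mat n x (enumerate ({1..} - \<alpha> ` {1..r}) i) (enumerate ({1..} - \<beta> ` {1..c}) j))"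

definition subset_prod_poly :: "nat \<Rightarrow> (nat \<Rightarrow> 'a::comm_ring_1) \<Rightarrow> nat \<Rightarrow> 'a poly" where
  "subset_prod_poly n x d = (\<Prod>\<sigma> | \<sigma> \<subseteq> {1..n} \<and> card \<sigma> = d. [:- (\<Prod>i\<in>\<sigma>. x i), 1:])"

definition Q_poly :: "nat \<Rightarrow> (nat \<Rightarrow> 'a::comm_ring_1) \<Rightarrow> nat \<Rightarrow> nat \<Rightarrow> 'a" where
  "Q_poly n x d m = coeff (subset_prod_poly n x d) ((n choose d) - m)"

lemma degree_subset_prod_poly: "degree (subset_prod_poly n x d) \<le> n choose d"
proof -
  let ?S = "{\<sigma>. \<sigma> \<subseteq> {1..n} \<and> card \<sigma> = d}"
  have fin: "finite ?S"
    by (rule finite_subset[of _ "Pow {1..n}"]) auto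
  have "degree (subset_prod_poly n x d) \<le> (\<Sum>\<sigma>\<in>?S. degree [:- (\<Prod>i\<in>\<sigma>. x i), 1:])"
    unfolding subset_prod_poly_def
    using degree_prod_sum_le[OF fin, of "\<lambda>\<sigma>. [:- (\<Prod>i\<in>\<sigma>. x i), 1:]"] by (simp only: o_def)
  also have "\<dots> = card ?S"
    by simp
  also have "\<dots> = n choose d"
    using n_subsets[of "{1..n}" d] by simp
  finally show ?thesis .
qed

lemma sum_Q_poly_monom:
  assumes "b = n choose d"
  shows "(\<Sum>k=0..b. monom (Q_poly n x d (b - k)) k) = subset_prod_poly n x d"
proof -
  have "(\<Sum>k=0..b. monom (Q_poly n x d (b - k)) k) = (\<Sum>k\<le>b. monom (coeff (subset_prod_poly n x d) k) k)"
    using assms by (intro sum.cong) (auto simp: Q_poly_def)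
  then show ?thesis
    using poly_as_sum_of_monoms'[OF degree_subset_prod_poly] assms by metis
qed

end

theory Submission
  imports Defs "HOL-Computational_Algebra.Formal_Power_Series"
begin

text \<open>
  Put \<open>d = c - r\<close>. The matrix \<open>A\<close> is unitriangular with inverse \<open>((-1)\<^sup>j\<^sup>-\<^sup>i h\<^sub>j\<^sub>-\<^sub>i)\<close>, so by
  Jacobi's complementary minor identity the minor \<open>det D\<^sup>k\<close> is, up to a sign \<open>\<plusminus>(-1)\<^sup>d\<^sup>k\<close>, a \<open>c \<times> c\<close>
  determinant in which \<open>r\<close> columns do not depend on \<open>k\<close> and the other \<open>d\<close> consist of complete
  homogeneous polynomials whose degrees grow with \<open>k\<close>. Use \<open>h\<^sub>m(x\<^sub>1, \<dots>, x\<^sub>n\<^sub>-\<^sub>i)\<close> in the \<open>i\<close>-th (from \<open>0\<close>) of these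
  columns. As \<open>h\<^sub>m\<^sub>+\<^sub>1(x\<^sub>1, \<dots>, x\<^sub>i) = x\<^sub>i h\<^sub>m(x\<^sub>1, \<dots>, x\<^sub>i) + h\<^sub>m\<^sub>+\<^sub>1(x\<^sub>1, \<dots>, x\<^sub>i\<^sub>-\<^sub>1)\<close>, the shift
  \<open>k \<mapsto> k + 1\<close> acts triangularly on the determinants indexed by \<open>d\<close>-subsets \<open>\<sigma>\<close> of \<open>[n]\<close>, with
  diagonal entries \<open>\<Prod>i\<in>\<sigma>. x\<^sub>i\<close>; hence \<open>\<Prod>\<sigma>. (shift - \<Prod>i\<in>\<sigma>. x\<^sub>i)\<close> annihilates them. No division
  is used, so the argument works over every commutative ring.
\<close>

section \<open>Polynomials in the shift operator, acting on sequences\<close>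

definition shift_act :: "'a::comm_ring_1 poly \<Rightarrow> (nat \<Rightarrow> 'a) \<Rightarrow> nat \<Rightarrow> 'a" where
  "shift_act p f t = (\<Sum>k\<le>degree p. coeff p k * f (k + t))"

lemma shift_act_altdef:
  assumes "degree p \<le> n"
  shows "shift_act p f t = (\<Sum>k\<le>n. coeff p k * f (k + t))"
  unfolding shift_act_def
  by (rule sum.mono_neutral_left) (use assms in \<open>auto simp: coeff_eq_0\<close>)

lemma shift_act_zero [simp]: "shift_act p (\<lambda>_. 0) = (\<lambda>_. 0)"
  by (auto simp: shift_act_def)

lemma shift_act_sum: "shift_act p (\<lambda>t. \<Sum>i\<in>I. a i * f i t) t = (\<Sum>i\<in>I. a i * shift_act p (f i) t)"
  unfolding shift_act_def sum_distrib_left by (subst sum.swap) (simp add: mult.left_commute)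

lemma shift_act_mult_left: "shift_act p (\<lambda>t. a * f t) t = a * shift_act p f t"
  by (simp add: shift_act_def sum_distrib_left mult.left_commute)

text \<open>The action turns products of polynomials into compositions, so a linear factor may be
  applied to \<open>f\<close> first. This peels one root at a time off a product.\<close>

lemma shift_act_linear_mult:
  "shift_act ([:- a, 1:] * p) f t = shift_act p (\<lambda>t. f (Suc t) - a * f t) t"
proof -
  let ?n = "degree p"
  have eq: "[:- a, 1:] * p = smult (- a) p + pCons 0 p"
    by simp
  have "degree ([:- a, 1:] * p) \<le> Suc ?n"
    unfolding eq by (intro degree_add_le) (auto simp: degree_pCons_le intro: le_trans[OF degree_smult_le])
  then have "shift_act ([:- a, 1:] * p) f t
      = (\<Sum>k\<le>Suc ?n. (- a * coeff p k + coeff (pCons 0 p) k) * f (k + t))"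
    unfolding eq by (subst shift_act_altdef[of _ "Suc ?n"]) auto
  also have "\<dots> = - a * (\<Sum>k\<le>Suc ?n. coeff p k * f (k + t)) + (\<Sum>k\<le>Suc ?n. coeff (pCons 0 p) k * f (k + t))"
    by (simp only: sum.distrib sum_distrib_left distrib_right mult.assoc)
  also have "(\<Sum>k\<le>Suc ?n. coeff p k * f (k + t)) = shift_act p f t"
    by (rule shift_act_altdef[symmetric]) simp
  also have "(\<Sum>k\<le>Suc ?n. coeff (pCons 0 p) k * f (k + t)) = shift_act p (\<lambda>t. f (Suc t)) t"
    by (subst sum.atMost_Suc_shift) (simp add: shift_act_def)
  finally show ?thesis
    by (simp add: shift_act_def sum_subtractf sum_negf sum_distrib_left right_diff_distrib mult.left_commute
        del: mult_pCons_left)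
qed

text \<open>Shift minus \<open>q * z\<close> sends \<open>q ^ t * f t\<close> to
  \<open>q * q ^ t * (f (Suc t) - z * f t)\<close>, so every factor releases one \<open>q\<close>.
  The later use is with a sign \<open>q\<close>.\<close>

lemma shift_act_twist:
  assumes "finite T"
  shows "shift_act (\<Prod>\<sigma>\<in>T. [:- (q * z \<sigma>), 1:]) (\<lambda>t. q ^ t * f t) t
       = q ^ (t + card T) * shift_act (\<Prod>\<sigma>\<in>T. [:- z \<sigma>, 1:]) f t"
  using assms
proof (induction T arbitrary: f rule: finite_induct)
  case empty
  show ?case by (simp add: shift_act_def)
next
  case (insert \<sigma> T)
  have eq: "(\<lambda>t. q ^ Suc t * f (Suc t) - q * z \<sigma> * (q ^ t * f t))
      = (\<lambda>t. q * (q ^ t * (f (Suc t) - z \<sigma> * f t)))"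
    by (rule ext) (simp add: algebra_simps)
  show ?case
    unfolding prod.insert[OF insert.hyps] shift_act_linear_mult eq shift_act_mult_left insert.IH
    by (simp add: insert.hyps)
qed

section \<open>Determinants with moving rows\<close>

text \<open>The \<open>k\<close>-dependent columns appear here transposed, as the first
  \<open>d\<close> rows; \<open>f i\<close> will be the number of variables used in row
  \<open>i\<close>.\<close>

definition row_det ::
  "(nat \<Rightarrow> nat \<Rightarrow> nat \<Rightarrow> 'a::comm_ring_1) \<Rightarrow> (nat \<Rightarrow> nat \<Rightarrow> 'a) \<Rightarrow> nat \<Rightarrow> nat \<Rightarrow> (nat \<Rightarrow> nat) \<Rightarrow> nat \<Rightarrow> 'a"
  where
  "row_det g C c d f t = det (mat c c (\<lambda>(i, p). if i < d then g (f i) t p else C i p))"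

text \<open>Multilinearity: each moving row is a sum of two rows, and \<open>S\<close> collects the
  rows in which the summand with unchanged index is chosen.\<close>

lemma row_det_expand:
  assumes "d \<le> c"
    and rec: "\<And>i p. i < d \<Longrightarrow> p < c \<Longrightarrow> g (f i) (Suc t) p = y (f i) * g (f i) t p + g (f i - 1) t p"
  shows "row_det g C c d f (Suc t) =
    (\<Sum>S\<in>Pow {..<d}. (\<Prod>i\<in>S. y (f i)) * row_det g C c d (\<lambda>i. if i \<in> S then f i else f i - 1) t)"
proof -
  let ?P = "{p. p permutes {0..<c}}"
  let ?f = "\<lambda>S i. if i \<in> S then f i else f i - 1"
  have split: "(\<Prod>i = 0..<c. mat c c (\<lambda>(i, p). if i < d then g (f i) t p else C i p) $$ (i, p i))
      = (\<Prod>i<d. g (f i) t (p i)) * (\<Prod>i\<in>{d..<c}. C i (p i))" if "p \<in> ?P" for p f t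
  proof -
    have p: "p i < c" if "i < c" for i
      using that \<open>p \<in> ?P\<close> by (auto dest: permutes_in_image[where x = i])
    have "{0..<c} = {..<d} \<union> {d..<c}" using \<open>d \<le> c\<close> by auto
    then show ?thesis
      using p \<open>d \<le> c\<close> by (simp add: prod.union_disjoint ivl_disj_int)
  qed
  have expand: "(\<Prod>i<d. g (f i) (Suc t) (p i))
      = (\<Sum>S\<in>Pow {..<d}. (\<Prod>i\<in>S. y (f i)) * (\<Prod>i<d. g (?f S i) t (p i)))" if "p \<in> ?P" for p
  proof -
    have p: "p i < c" if "i < d" for i
      using that \<open>p \<in> ?P\<close> \<open>d \<le> c\<close> by (auto dest: permutes_in_image[where x = i])
    have "(\<Prod>i<d. g (f i) (Suc t) (p i)) = (\<Prod>i<d. y (f i) * g (f i) t (p i) + g (f i - 1) t (p i))"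
      using p by (intro prod.cong) (auto simp: rec)
    also have "\<dots> = (\<Sum>S\<in>Pow {..<d}. (\<Prod>i\<in>S. y (f i) * g (f i) t (p i)) * (\<Prod>i\<in>{..<d} - S. g (f i - 1) t (p i)))"
      by (rule prod_add) simp
    also have "\<dots> = (\<Sum>S\<in>Pow {..<d}. (\<Prod>i\<in>S. y (f i)) * (\<Prod>i<d. g (?f S i) t (p i)))"
    proof (rule sum.cong[OF refl])
      fix S assume "S \<in> Pow {..<d}"
      then have "(\<Prod>i<d. g (?f S i) t (p i)) = (\<Prod>i\<in>S. g (f i) t (p i)) * (\<Prod>i\<in>{..<d} - S. g (f i - 1) t (p i))"
        by (subst prod.subset_diff[of S]) (auto intro!: prod.cong simp: mult.commute)
      then show "(\<Prod>i\<in>S. y (f i) * g (f i) t (p i)) * (\<Prod>i\<in>{..<d} - S. g (f i - 1) t (p i))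
          = (\<Prod>i\<in>S. y (f i)) * (\<Prod>i<d. g (?f S i) t (p i))"
        by (simp add: prod.distrib mult.assoc)
    qed
    finally show ?thesis .
  qed
  have "row_det g C c d f (Suc t)
      = (\<Sum>p\<in>?P. \<Sum>S\<in>Pow {..<d}. (\<Prod>i\<in>S. y (f i)) *
          (signof p * ((\<Prod>i<d. g (?f S i) t (p i)) * (\<Prod>i\<in>{d..<c}. C i (p i)))))"
    unfolding row_det_def
    by (subst det_def'[OF mat_carrier], rule sum.cong[OF refl],
        simp only: split expand sum_distrib_left sum_distrib_right)
      (simp add: algebra_simps)
  also have "\<dots> = (\<Sum>S\<in>Pow {..<d}. (\<Prod>i\<in>S. y (f i)) * row_det g C c d (?f S) t)"
    unfolding row_det_def
    by (subst sum.swap, rule sum.cong[OF refl], subst det_def'[OF mat_carrier],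
        simp only: split sum_distrib_left cong: sum.cong)
  finally show ?thesis .
qed

lemma row_det_eq_0_not_inj:
  assumes "d \<le> c" "\<not> inj_on f {..<d}"
  shows "row_det g C c d f t = 0"
proof -
  obtain i i' where *: "i < d" "i' < d" "i \<noteq> i'" "f i = f i'"
    using assms(2) by (auto simp: inj_on_def)
  show ?thesis
    unfolding row_det_def
    by (rule det_identical_rows[where n = c and i = i and j = i'])
      (use * assms(1) in \<open>auto intro!: eq_vecI\<close>)
qed

lemma row_det_eq_0_row:
  assumes "d \<le> c" "i < d" "\<And>p. p < c \<Longrightarrow> g (f i) t p = 0"
  shows "row_det g C c d f t = 0"
  unfolding row_det_def
  by (subst laplace_expansion_row[OF mat_carrier, of i]) (use assms in auto)

lemma shift_act_row_det_eq_0: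
  fixes y :: "nat \<Rightarrow> 'a::comm_ring_1"
  assumes "d \<le> c"
    and rec: "\<And>i p t. 1 \<le> i \<Longrightarrow> i \<le> n \<Longrightarrow> p < c \<Longrightarrow> g i (Suc t) p = y i * g i t p + g (i - 1) t p"
    and zero: "\<And>p t. p < c \<Longrightarrow> g 0 t p = 0"
    and "finite T"
    and "\<And>\<sigma>. \<sigma> \<subseteq> {1..n} \<Longrightarrow> card \<sigma> = d \<Longrightarrow> \<Sum>\<sigma> \<le> (\<Sum>i<d. f i) \<Longrightarrow> \<sigma> \<in> T"
    and "\<And>i. i < d \<Longrightarrow> f i \<le> n"
  shows "shift_act (\<Prod>\<sigma>\<in>T. [:- (\<Prod>i\<in>\<sigma>. y i), 1:]) (row_det g C c d f) = (\<lambda>_. 0)"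
  using assms(4-6)
proof (induction "\<Sum>i<d. f i" arbitrary: f T rule: less_induct)
  case less
  show ?case
  proof (cases "inj_on f {..<d} \<and> (\<forall>i<d. f i \<noteq> 0)")
    case False
    then have "row_det g C c d f t = 0" for t
      using row_det_eq_0_not_inj[OF assms(1)] row_det_eq_0_row[OF assms(1)] zero
      by metis
    then have "row_det g C c d f = (\<lambda>_. 0)" ..
    then show ?thesis by simp
  next
    case True
    define \<sigma> where "\<sigma> = f ` {..<d}"
    have inj: "inj_on f {..<d}" using True by blast
    have "\<sigma> \<in> T"
      using True less.prems(3)
      by (intro less.prems(2)) (auto simp: \<sigma>_def card_image sum.reindex Suc_le_eq)
    define T' where "T' = T - {\<sigma>}"
    have T: "T = insert \<sigma> T'" "\<sigma> \<notin> T'" "finite T'"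
      using \<open>\<sigma> \<in> T\<close> less.prems(1) by (auto simp: T'_def)
    let ?f = "\<lambda>S i. if i \<in> S then f i else f i - 1"
    \<comment> \<open>The excluded choice lowers no index: it is the diagonal term.\<close>
    let ?S = "Pow {..<d} - {{..<d}}"
    have step: "row_det g C c d f (Suc t) - (\<Prod>i\<in>\<sigma>. y i) * row_det g C c d f t
        = (\<Sum>S\<in>?S. (\<Prod>i\<in>S. y (f i)) * row_det g C c d (?f S) t)" for t
    proof -
      have "row_det g C c d f (Suc t) = (\<Sum>S\<in>Pow {..<d}. (\<Prod>i\<in>S. y (f i)) * row_det g C c d (?f S) t)"
        using True less.prems(3) by (intro row_det_expand assms(1) rec) (auto simp: Suc_le_eq)
      also have "\<dots> = (\<Prod>i<d. y (f i)) * row_det g C c d (?f {..<d}) t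
          + (\<Sum>S\<in>?S. (\<Prod>i\<in>S. y (f i)) * row_det g C c d (?f S) t)"
        by (rule sum.remove) auto
      also have "row_det g C c d (?f {..<d}) t = row_det g C c d f t"
        unfolding row_det_def using assms(1) by (intro arg_cong[where f = det] eq_matI) auto
      also have "(\<Prod>i<d. y (f i)) = (\<Prod>i\<in>\<sigma>. y i)"
        using inj by (simp add: \<sigma>_def prod.reindex)
      finally show ?thesis by simp
    qed
    have IH: "shift_act (\<Prod>\<sigma>\<in>T'. [:- (\<Prod>i\<in>\<sigma>. y i), 1:]) (row_det g C c d (?f S)) = (\<lambda>_. 0)"
      if S: "S \<in> ?S" for S
    proof -
      have lt: "(\<Sum>i<d. ?f S i) < (\<Sum>i<d. f i)"
      proof (rule sum_strict_mono_ex1)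
        obtain i where "i < d" "i \<notin> S" using S by auto
        then show "\<exists>i\<in>{..<d}. ?f S i < f i" using True by (intro bexI[of _ i]) auto
      qed auto
      \<comment> \<open>Hence \<open>\<sigma>\<close> exceeds the new, smaller bound, and
        \<open>T'\<close> still contains every subset required.\<close>
      have sum\<sigma>: "\<Sum>\<sigma> = (\<Sum>i<d. f i)"
        using inj by (simp add: \<sigma>_def sum.reindex)
      show ?thesis
        by (rule less.hyps[OF lt T(3)]) (use less.prems lt sum\<sigma> in \<open>fastforce simp: T'_def\<close>, 
            use less.prems in \<open>auto intro: le_trans[OF diff_le_self]\<close>)
    qed
    show ?thesis
    proof
      fix t
      show "shift_act (\<Prod>\<sigma>\<in>T. [:- (\<Prod>i\<in>\<sigma>. y i), 1:]) (row_det g C c d f) t = 0"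
        unfolding T(1) prod.insert[OF T(3) T(2)] shift_act_linear_mult step shift_act_sum
        by (intro sum.neutral ballI) (simp only: IH mult_zero_right)
    qed
  qed
qed

section \<open>Power series of elementary and complete homogeneous polynomials\<close>

definition elem_fps :: "(nat \<Rightarrow> 'a::comm_ring_1) \<Rightarrow> nat \<Rightarrow> 'a fps" where
  "elem_fps x n = (\<Prod>i=1..n. fps_const (x i) * fps_X + 1)"

text \<open>The coefficient of \<open>X\<^sup>m\<close> is \<open>(-1)\<^sup>m h\<^sub>m(x\<^sub>1, \<dots>, x\<^sub>n)\<close>.\<close>

primrec hom_fps :: "(nat \<Rightarrow> 'a::comm_ring_1) \<Rightarrow> nat \<Rightarrow> 'a fps" where
  "hom_fps x 0 = 1"
| "hom_fps x (Suc n) = Abs_fps (\<lambda>k. (- x (Suc n)) ^ k) * hom_fps x n"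

text \<open>Integer indices with value 0 below 0 describe upper triangular Toeplitz matrices without
  truncated subtraction.\<close>

definition fps_int_nth :: "'a::comm_ring_1 fps \<Rightarrow> int \<Rightarrow> 'a" where
  "fps_int_nth F m = (if m < 0 then 0 else fps_nth F (nat m))"

lemma fps_int_nth_of_nat [simp]: "fps_int_nth F (int m) = fps_nth F m"
  by (simp add: fps_int_nth_def)

lemma fps_int_nth_neg [simp]: "m < 0 \<Longrightarrow> fps_int_nth F m = 0"
  by (simp add: fps_int_nth_def)

lemma elem_fps_nth: "fps_nth (elem_fps x n) m = elem_sym n x m"
proof -
  have "elem_fps x n = (\<Sum>\<sigma>\<in>Pow {1..n}. \<Prod>i\<in>\<sigma>. fps_const (x i) * fps_X)"
    unfolding elem_fps_def by (subst prod_add) auto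
  also have "\<dots> = (\<Sum>\<sigma>\<in>Pow {1..n}. fps_const (\<Prod>i\<in>\<sigma>. x i) * fps_X ^ card \<sigma>)"
  proof (rule sum.cong[OF refl])
    fix \<sigma> assume "\<sigma> \<in> Pow {1..n}"
    then have "finite \<sigma>" by (auto intro: finite_subset)
    then have "(\<Prod>i\<in>\<sigma>. fps_const (x i)) = fps_const (\<Prod>i\<in>\<sigma>. x i)"
      by (induction \<sigma> rule: finite_induct) simp_all
    then show "(\<Prod>i\<in>\<sigma>. fps_const (x i) * fps_X) = fps_const (\<Prod>i\<in>\<sigma>. x i) * fps_X ^ card \<sigma>"
      by (simp add: prod.distrib)
  qed
  finally have "fps_nth (elem_fps x n) m
      = (\<Sum>\<sigma>\<in>Pow {1..n}. if card \<sigma> = m then \<Prod>i\<in>\<sigma>. x i else 0)"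
    by (auto simp: fps_sum_nth fps_X_power_nth intro!: sum.cong)
  also have "\<dots> = (\<Sum>\<sigma>\<in>{\<sigma> \<in> Pow {1..n}. card \<sigma> = m}. \<Prod>i\<in>\<sigma>. x i)"
    by (rule sum.inter_filter[symmetric]) simp
  finally show ?thesis
    by (simp add: elem_sym_def)
qed

text \<open>The cut-off above \<open>n\<close> is automatic, as \<open>{1..n}\<close> has no larger
  subsets; thus \<open>A\<close> is the Toeplitz matrix of one power series.\<close>

lemma s_sym_eq: "s_sym n x m = fps_int_nth (elem_fps x n) m"
proof -
  have "elem_sym n x i = 0" if "i > n" for i
  proof -
    have "card \<sigma> \<noteq> i" if "\<sigma> \<subseteq> {1..n}" for \<sigma>
      using card_mono[OF _ that] \<open>i > n\<close> by auto
    then show ?thesis unfolding elem_sym_def by (intro sum.neutral) auto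
  qed
  then show ?thesis
    by (auto simp: s_sym_def fps_int_nth_def elem_fps_nth)
qed

lemma linear_mult_geometric:
  fixes a :: "'a::comm_ring_1"
  shows "(fps_const a * fps_X + 1) * Abs_fps (\<lambda>k. (- a) ^ k) = 1"
proof (rule fps_ext)
  fix m
  show "fps_nth ((fps_const a * fps_X + 1) * Abs_fps (\<lambda>k. (- a) ^ k)) m = fps_nth 1 m"
    by (cases m) (simp_all add: distrib_right mult.assoc)
qed

lemma elem_fps_Suc: "elem_fps x (Suc n) = (fps_const (x (Suc n)) * fps_X + 1) * elem_fps x n"
  by (simp add: elem_fps_def mult.commute)

lemma elem_fps_mult_hom_fps: "elem_fps x n * hom_fps x n = 1"
proof (induction n)
  case (Suc n)
  have "elem_fps x (Suc n) * hom_fps x (Suc n)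
      = ((fps_const (x (Suc n)) * fps_X + 1) * Abs_fps (\<lambda>k. (- x (Suc n)) ^ k)) * (elem_fps x n * hom_fps x n)"
    unfolding elem_fps_Suc hom_fps.simps by (simp only: mult_ac)
  then show ?case
    by (simp only: linear_mult_geometric Suc.IH mult_1)
qed (simp add: elem_fps_def)

text \<open>The product is that of the \<open>i\<close> remaining linear factors, a polynomial of
  degree at most \<open>i\<close>. This permits fewer variables in the moving columns.\<close>

lemma elem_fps_mult_hom_fps_nth:
  "fps_nth (elem_fps x (n + i) * hom_fps x n) 0 = 1"
  "m > i \<Longrightarrow> fps_nth (elem_fps x (n + i) * hom_fps x n) m = 0"
proof (induction i arbitrary: m)
  case 0
  { case 1 show ?case by (simp add: elem_fps_mult_hom_fps) }
  { case 2 then show ?case by (simp add: elem_fps_mult_hom_fps) }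
next
  case (Suc i)
  have eq: "elem_fps x (n + Suc i) * hom_fps x n
      = elem_fps x (n + i) * hom_fps x n
        + fps_const (x (Suc (n + i))) * (fps_X * (elem_fps x (n + i) * hom_fps x n))"
    by (simp add: elem_fps_Suc algebra_simps)
  { case 1 show ?case unfolding eq by (simp only: fps_add_nth Suc.IH(1)) simp }
  { case 2 then show ?case unfolding eq using Suc.IH(2)[of m] Suc.IH(2)[of "m - 1"] by simp }
qed

text \<open>Coefficient comparison in
  \<open>(1 + x i * X) * hom_fps x i = hom_fps x (i - 1)\<close>; at \<open>m = -1\<close> it
  compares the constant terms.\<close>

lemma hom_fps_rec:
  assumes "1 \<le> i"
  shows "fps_int_nth (hom_fps x i) (m + 1)
    = - x i * fps_int_nth (hom_fps x i) m + fps_int_nth (hom_fps x (i - 1)) (m + 1)"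
proof -
  obtain l where i: "i = Suc l" using assms by (cases i) auto
  have *: "(fps_const (x i) * fps_X + 1) * hom_fps x i = hom_fps x l"
    unfolding i hom_fps.simps mult.assoc[symmetric] linear_mult_geometric by simp
  show ?thesis
  proof (cases "m + 1 \<le> 0")
    case True
    then show ?thesis
      using arg_cong[OF *, of "\<lambda>F. fps_nth F 0"] by (auto simp: fps_int_nth_def i)
  next
    case False
    then obtain k where m: "m = int k" using nonneg_int_cases[of m] by auto
    have "fps_nth (hom_fps x l) (Suc k) = x i * fps_nth (hom_fps x i) k + fps_nth (hom_fps x i) (Suc k)"
      unfolding *[symmetric] by (simp add: distrib_right mult.assoc)
    moreover have "m + 1 = int (Suc k)" using m by simp
    ultimately show ?thesis by (simp only: m fps_int_nth_of_nat i diff_Suc_1) simp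
  qed
qed

text \<open>Toeplitz matrices multiply like their series. Cutting the sum to \<open>1..M\<close> is
  harmless, since only \<open>a\<close> from \<open>i\<close> to \<open>i'\<close>
  contribute.\<close>

lemma fps_int_nth_mult:
  assumes "1 \<le> i" "i' \<le> M"
  shows "(\<Sum>a=1..M. fps_int_nth F (int a - int i) * fps_int_nth G (int i' - int a))
    = fps_int_nth (F * G) (int i' - int i)"
proof (cases "i \<le> i'")
  case False
  then show ?thesis by (auto intro!: sum.neutral simp: fps_int_nth_def)
next
  case True
  have "(\<Sum>a=1..M. fps_int_nth F (int a - int i) * fps_int_nth G (int i' - int a))
      = (\<Sum>a=i..i'. fps_int_nth F (int a - int i) * fps_int_nth G (int i' - int a))"
    by (rule sum.mono_neutral_right) (use assms in \<open>auto simp: fps_int_nth_def\<close>)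
  also have "\<dots> = (\<Sum>l=0..i' - i. fps_nth F l * fps_nth G (i' - i - l))"
    by (rule sum.reindex_bij_witness[of _ "\<lambda>l. l + i" "\<lambda>a. a - i"])
      (use True in \<open>auto simp: fps_int_nth_def nat_diff_distrib' algebra_simps\<close>)
  also have "\<dots> = fps_nth (F * G) (i' - i)"
    by (simp add: fps_mult_nth)
  finally show ?thesis
    using True by (simp add: fps_int_nth_def nat_diff_distrib')
qed

section \<open>Jacobi's complementary minor identity\<close>

lemma det_unit_row:
  fixes A :: "'a::comm_ring_1 mat"
  assumes "A \<in> carrier_mat (Suc m) (Suc m)" "p \<le> m" "q \<le> m"
    and "\<And>v. v \<le> m \<Longrightarrow> A $$ (p, v) = (if v = q then 1 else 0)"
  shows "det A = (- 1) ^ (p + q) * det (mat_delete A p q)"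
proof -
  have "det A = (\<Sum>v<Suc m. A $$ (p, v) * cofactor A p v)"
    by (rule laplace_expansion_row[OF assms(1)]) (use assms(2) in simp)
  also have "\<dots> = (\<Sum>v<Suc m. if v = q then cofactor A p v else 0)"
    by (rule sum.cong) (auto simp: assms(4))
  also have "\<dots> = cofactor A p q"
    using assms(3) by simp
  finally show ?thesis by (simp add: cofactor_def)
qed

text \<open>The library computes determinants of block matrices only over integral domains.\<close>

lemma det_unit_rows_bottom:
  "det (mat (k + c) (k + c) (\<lambda>(u, v). if u < k then f u v else if u = v then 1 else 0))
    = det (mat k k (\<lambda>(u, v). f u v :: 'a::comm_ring_1))"
proof (induction c)
  case 0
  show ?case by (intro arg_cong[where f = det] eq_matI) auto
next
  case (Suc c)
  let ?B = "\<lambda>m. mat m m (\<lambda>(u, v). if u < k then f u v else if u = v then 1 else 0)"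
  have "det (?B (Suc (k + c))) = det (mat_delete (?B (Suc (k + c))) (k + c) (k + c))"
    by (subst det_unit_row[of _ "k + c" "k + c" "k + c"]) (auto simp flip: mult_2)
  also have "mat_delete (?B (Suc (k + c))) (k + c) (k + c) = ?B (k + c)"
    by (rule eq_matI) (auto simp: mat_delete_def)
  finally show ?case using Suc.IH by simp
qed

lemma det_unit_rows_top:
  "det (mat (k + c) (k + c) (\<lambda>(u, v). if u < k then if u = v then 1 else 0 else f u v))
    = det (mat c c (\<lambda>(u, v). f (k + u) (k + v) :: 'a::comm_ring_1))"
proof (induction k arbitrary: f)
  case 0
  show ?case by simp
next
  case (Suc k)
  let ?B = "mat (Suc (k + c)) (Suc (k + c)) (\<lambda>(u, v). if u < Suc k then if u = v then 1 else 0 else f u v)"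
  have "det ?B = det (mat_delete ?B 0 0)"
    by (subst det_unit_row[of _ "k + c" 0 0]) auto
  also have "mat_delete ?B 0 0
      = mat (k + c) (k + c) (\<lambda>(u, v). if u < k then if u = v then 1 else 0 else f (Suc u) (Suc v))"
    by (rule eq_matI) (auto simp: mat_delete_def)
  finally show ?case by (simp add: Suc.IH)
qed

text \<open>
  In \<open>label\<close> the retained indices come first and the \<open>k\<close>-independent ones last; \<open>row_label\<close> moreover
  places the \<open>d\<close> new indices \<open>k + r + 1, \<dots>, k + r + d\<close> in between, not at the end. With this order
  passing from \<open>k\<close> to \<open>k + 1\<close> removes the last of them by a single Laplace expansion, and no
  permutation signs arise.
\<close>

definition label :: "(nat \<Rightarrow> nat) \<Rightarrow> (nat \<Rightarrow> nat) \<Rightarrow> nat \<Rightarrow> nat \<Rightarrow> nat" where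
  "label I \<alpha> k u = (if u < k then I u else \<alpha> (u - k + 1))"

definition row_label :: "(nat \<Rightarrow> nat) \<Rightarrow> (nat \<Rightarrow> nat) \<Rightarrow> nat \<Rightarrow> nat \<Rightarrow> nat \<Rightarrow> nat \<Rightarrow> nat" where
  "row_label I \<alpha> r d k u =
     (if u < k then I u else if u < k + d then r + u + 1 else label I \<alpha> k (u - d))"

text \<open>For the labels above and constant coefficient 1 this is a unitriangular matrix with rows
  and columns permuted. Its determinant is a sign, which is never computed.\<close>

definition full_mat :: "'a::comm_ring_1 fps \<Rightarrow> (nat \<Rightarrow> nat) \<Rightarrow> (nat \<Rightarrow> nat) \<Rightarrow> nat \<Rightarrow> 'a mat" where
  "full_mat E \<rho> \<gamma> m = mat m m (\<lambda>(u, v). fps_int_nth E (int (\<gamma> v) - int (\<rho> u)))"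

text \<open>\<open>det K * det U = 1\<close>, while \<open>B * U\<close> begins with
  \<open>k\<close> unit rows, so \<open>det B * det U\<close> is the determinant of the lower right
  block of \<open>U\<close>. Multiplying by \<open>det K\<close> isolates the minor
  \<open>det B\<close>.\<close>

lemma det_minor_eq:
  fixes E H :: "'a::comm_ring_1 fps" and H' :: "nat \<Rightarrow> 'a fps"
    and I J \<alpha> \<beta> :: "nat \<Rightarrow> nat" and r d k :: nat
  defines "\<rho> \<equiv> row_label I \<alpha> r d k" and "\<gamma> \<equiv> label J \<beta> k"
  assumes rows: "bij_betw (label I \<alpha> k) {..<k + r} {1..k + r}"
    and cols: "bij_betw \<gamma> {..<k + (d + r)} {1..k + (d + r)}"
    and EH: "E * H = 1"
    and EH': "\<And>i. i < d \<Longrightarrow> fps_nth (E * H' i) 0 = 1"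
      "\<And>i m. i < d \<Longrightarrow> i < m \<Longrightarrow> fps_nth (E * H' i) m = 0"
  shows "det (mat k k (\<lambda>(u, v). fps_int_nth E (int (J v) - int (I u))))
    = det (full_mat E \<rho> \<gamma> (k + (d + r)))
      * det (mat (d + r) (d + r) (\<lambda>(p, w). fps_int_nth (if w < d then H' w else H)
          (int (\<rho> (k + w)) - int (\<beta> (p + 1)))))"
proof -
  define M where "M = k + (d + r)"
  \<comment> \<open>The middle columns use \<open>H'\<close> instead of the true inverse
    \<open>H\<close>; this disturbs \<open>K * U\<close> only above the diagonal, inside the middle
    block.\<close>
  define F where "F w = (if w < k then H else if w < k + d then H' (w - k) else H)" for w
  define K where "K = full_mat E \<rho> \<gamma> M"
  define U where "U = mat M M (\<lambda>(v, w). fps_int_nth (F w) (int (\<rho> w) - int (\<gamma> v)))"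
  define B where "B = mat M M (\<lambda>(u, v). if u < k then fps_int_nth E (int (\<gamma> v) - int (\<rho> u))
      else if u = v then 1 else 0)"
  \<comment> \<open>\<open>K * U\<close> is unitriangular, and \<open>B\<close> is \<open>K\<close> with its lower rows replaced by unit rows.\<close>
  have carrier: "K \<in> carrier_mat M M" "U \<in> carrier_mat M M" "B \<in> carrier_mat M M"
    by (auto simp: K_def full_mat_def U_def B_def)
  have outer: "1 \<le> \<rho> u \<and> \<rho> u \<le> k + r" if "u < M" "u < k \<or> k + d \<le> u" for u
  proof -
    have "label I \<alpha> k (if u < k then u else u - d) \<in> {1..k + r}"
      using that by (intro bij_betwE[OF rows, rule_format]) (auto simp: M_def)
    then show ?thesis
      using that by (auto simp: \<rho>_def row_label_def label_def split: if_splits)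
  qed
  have mid: "\<rho> u = r + u + 1" if "k \<le> u" "u < k + d" for u
    using that by (simp add: \<rho>_def row_label_def)
  have range: "1 \<le> \<rho> u \<and> \<rho> u \<le> M" if "u < M" for u
    using outer[OF that] mid[of u] by (cases "k \<le> u \<and> u < k + d") (auto simp: M_def)
  have inj: "\<rho> u = \<rho> w \<longleftrightarrow> u = w" if "u < M" "w < M" for u w
  proof (cases "(k \<le> u \<and> u < k + d) \<or> (k \<le> w \<and> w < k + d)")
    case True
    then show ?thesis
      using outer[OF that(1)] outer[OF that(2)] mid[of u] mid[of w]
      by (cases "k \<le> u \<and> u < k + d"; cases "k \<le> w \<and> w < k + d") (simp_all, linarith+)
  next
    case False
    let ?h = "\<lambda>u. if u < k then u else u - d"
    have "\<rho> u = label I \<alpha> k (?h u)" "\<rho> w = label I \<alpha> k (?h w)"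
      using False by (auto simp: \<rho>_def row_label_def label_def)
    moreover have "?h u \<in> {..<k + r}" "?h w \<in> {..<k + r}"
      using that False by (auto simp: M_def)
    ultimately have "\<rho> u = \<rho> w \<longleftrightarrow> ?h u = ?h w"
      using rows by (auto simp: bij_betw_def inj_on_eq_iff)
    then show ?thesis using False by auto
  qed
  have conv: "(\<Sum>v = 0..<M. fps_int_nth E (int (\<gamma> v) - int (\<rho> u)) * fps_int_nth (F w) (int (\<rho> w) - int (\<gamma> v)))
      = fps_int_nth (E * F w) (int (\<rho> w) - int (\<rho> u))" if "u < M" "w < M" for u w
  proof -
    have "(\<Sum>v = 0..<M. fps_int_nth E (int (\<gamma> v) - int (\<rho> u)) * fps_int_nth (F w) (int (\<rho> w) - int (\<gamma> v)))
        = (\<Sum>a = 1..M. fps_int_nth E (int a - int (\<rho> u)) * fps_int_nth (F w) (int (\<rho> w) - int a))"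
      using cols unfolding M_def
      by (intro sum.reindex_bij_betw[where h = \<gamma>]) (simp add: atLeast0LessThan)
    also have "\<dots> = fps_int_nth (E * F w) (int (\<rho> w) - int (\<rho> u))"
      using range that by (intro fps_int_nth_mult) auto
    finally show ?thesis .
  qed
  have EH0: "fps_nth E 0 * fps_nth H 0 = 1"
    using arg_cong[OF EH, of "\<lambda>F. fps_nth F 0"] by simp
  have prod_outer: "fps_int_nth (E * F w) (int (\<rho> w) - int (\<rho> u)) = (if u = w then 1 else 0)"
    if "u < M" "w < M" "w < k \<or> k + d \<le> w" for u w
    using that inj[of u w] EH0 by (auto simp: F_def EH fps_int_nth_def)
  have prod_mid: "fps_int_nth (E * F w) (int (\<rho> w) - int (\<rho> u)) = 0"
    if "u < M" "k \<le> w" "w < k + d" "u < k \<or> k + d \<le> u" for u w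
  proof -
    \<comment> \<open>The middle label is \<open>r + w + 1\<close> and outer labels are at most
      \<open>k + r\<close>, so the index passes the degree bound \<open>w - k\<close> by at least
      one.\<close>
    have "w - k < nat (int (\<rho> w) - int (\<rho> u))"
      using outer[of u] that by (auto simp: mid)
    then show ?thesis
      using that by (auto simp: fps_int_nth_def F_def intro!: EH'(2))
  qed
  have KU: "(K * U) $$ (u, w) = fps_int_nth (E * F w) (int (\<rho> w) - int (\<rho> u))" if "u < M" "w < M" for u w
    using that conv[OF that] by (simp add: K_def full_mat_def U_def scalar_prod_def)
  have "upper_triangular (K * U)"
  proof (rule upper_triangularI)
    fix u w assume "w < u" "u < dim_row (K * U)"
    then have *: "w < u" "u < M" "w < M" using carrier by auto
    show "(K * U) $$ (u, w) = 0"
    proof (cases "k \<le> w \<and> w < k + d \<and> u < k + d")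
      case True
      then show ?thesis using * by (simp add: KU mid)
    next
      case False
      then show ?thesis
        using * prod_outer[of u w] prod_mid[of u w]
        by (cases "k \<le> w \<and> w < k + d") (auto simp: KU not_less)
    qed
  qed
  then have "det (K * U) = (\<Prod>u = 0..<M. (K * U) $$ (u, u))"
    using carrier by (subst det_upper_triangular[of _ M]) (auto simp: prod_list_diag_prod)
  also have "\<dots> = 1"
  proof (rule prod.neutral, intro ballI)
    fix u assume "u \<in> {0..<M}"
    then show "(K * U) $$ (u, u) = 1"
      using prod_outer[of u u] EH'(1)[of "u - k"]
      by (cases "k \<le> u \<and> u < k + d") (auto simp: KU F_def fps_int_nth_def not_less)
  qed
  finally have detKU: "det K * det U = 1"
    using carrier by (simp add: det_mult)
  have BU: "B * U = mat M M (\<lambda>(u, w). if u < k then if u = w then 1 else 0 else U $$ (u, w))"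
  proof (rule eq_matI)
    fix u w assume "u < dim_row (mat M M (\<lambda>(u, w). if u < k then if u = w then 1 else 0 else U $$ (u, w)))"
      "w < dim_col (mat M M (\<lambda>(u, w). if u < k then if u = w then 1 else 0 else U $$ (u, w)))"
    then have *: "u < M" "w < M" by auto
    have "(B * U) $$ (u, w) = (if u < k then if u = w then 1 else 0 else U $$ (u, w))"
    proof (cases "u < k")
      case True
      then have "(B * U) $$ (u, w) = fps_int_nth (E * F w) (int (\<rho> w) - int (\<rho> u))"
        using * conv[of u w] by (simp add: B_def U_def scalar_prod_def)
      then show ?thesis
        using True * prod_outer[of u w] prod_mid[of u w] by (cases "k \<le> w \<and> w < k + d") (auto simp: not_less)
    next
      case False
      have "(B * U) $$ (u, w) = (\<Sum>v = 0..<M. B $$ (u, v) * U $$ (v, w))"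
        using * carrier by (simp add: scalar_prod_def)
      also have "\<dots> = (\<Sum>v = 0..<M. if v = u then U $$ (v, w) else 0)"
        by (rule sum.cong) (use False * in \<open>auto simp: B_def\<close>)
      finally have "(B * U) $$ (u, w) = (\<Sum>v = 0..<M. if v = u then U $$ (v, w) else 0)" .
      then show ?thesis using False * by simp
    qed
    then show "(B * U) $$ (u, w)
        = mat M M (\<lambda>(u, w). if u < k then if u = w then 1 else 0 else U $$ (u, w)) $$ (u, w)"
      using * by simp
  qed (use carrier in auto)
  have "det B = det (mat k k (\<lambda>(u, v). fps_int_nth E (int (\<gamma> v) - int (\<rho> u))))"
    unfolding B_def M_def by (rule det_unit_rows_bottom)
  also have "mat k k (\<lambda>(u, v). fps_int_nth E (int (\<gamma> v) - int (\<rho> u)))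
      = mat k k (\<lambda>(u, v). fps_int_nth E (int (J v) - int (I u)))"
    by (rule eq_matI) (auto simp: \<gamma>_def \<rho>_def label_def row_label_def)
  finally have detB: "det B = det (mat k k (\<lambda>(u, v). fps_int_nth E (int (J v) - int (I u))))" .
  have "det (B * U) = det (mat (d + r) (d + r) (\<lambda>(p, w). U $$ (k + p, k + w)))"
    unfolding BU unfolding M_def by (rule det_unit_rows_top)
  also have "mat (d + r) (d + r) (\<lambda>(p, w). U $$ (k + p, k + w))
      = mat (d + r) (d + r) (\<lambda>(p, w). fps_int_nth (if w < d then H' w else H)
          (int (\<rho> (k + w)) - int (\<beta> (p + 1))))" (is "_ = ?W")
    by (rule eq_matI) (auto simp: U_def M_def F_def \<gamma>_def label_def)
  finally have "det B * det U = det ?W"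
    using carrier by (simp add: det_mult)
  then have "det K * det ?W = det B * (det K * det U)"
    by (metis mult.left_commute)
  also have "\<dots> = det B"
    by (simp add: detKU)
  finally show ?thesis
    unfolding detB by (simp add: K_def M_def)
qed

text \<open>The largest label sits in row \<open>k + d\<close> and column \<open>k\<close>. By
  triangularity that row is a unit row, and deleting both leaves the matrix for \<open>k\<close>,
  with sign \<open>(-1) ^ (k + d + k)\<close>.\<close>

lemma det_full_mat_Suc:
  assumes cols: "bij_betw (label J \<beta> (Suc k)) {..<Suc k + (d + r)} {1..Suc k + (d + r)}"
    and "I k = k + r + 1" "J k = k + (d + r) + 1" and "fps_nth E 0 = 1"
  shows "det (full_mat E (row_label I \<alpha> r d (Suc k)) (label J \<beta> (Suc k)) (Suc k + (d + r)))
    = (- 1) ^ d * det (full_mat E (row_label I \<alpha> r d k) (label J \<beta> k) (k + (d + r)))"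
proof -
  let ?M = "k + (d + r)"
  let ?\<gamma> = "label J \<beta> (Suc k)" and ?\<rho> = "row_label I \<alpha> r d (Suc k)"
  let ?A = "full_mat E ?\<rho> ?\<gamma> (Suc ?M)"
  have row: "?\<rho> (k + d) = Suc ?M"
    using assms(2) by (auto simp: row_label_def label_def)
  have col: "?\<gamma> v \<le> Suc ?M" "?\<gamma> v = Suc ?M \<longleftrightarrow> v = k" if "v \<le> ?M" for v
  proof -
    have k: "?\<gamma> k = Suc ?M" using assms(3) by (simp add: label_def)
    show "?\<gamma> v \<le> Suc ?M"
      using bij_betwE[OF cols] that by auto
    show "?\<gamma> v = Suc ?M \<longleftrightarrow> v = k"
      unfolding k[symmetric] using cols that by (auto simp: bij_betw_def inj_on_eq_iff)
  qed
  have "det ?A = (- 1) ^ (k + d + k) * det (mat_delete ?A (k + d) k)"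
  proof (rule det_unit_row)
    fix v assume "v \<le> ?M"
    then show "?A $$ (k + d, v) = (if v = k then 1 else 0)"
      using col[of v] by (auto simp: full_mat_def row fps_int_nth_def assms(4))
  qed (auto simp: full_mat_def)
  also have "mat_delete ?A (k + d) k = full_mat E (row_label I \<alpha> r d k) (label J \<beta> k) ?M"
  proof -
    have del_col: "?\<gamma> (if v < k then v else Suc v) = label J \<beta> k v" for v
      by (simp add: label_def)
    have del_row: "?\<rho> (if u < k + d then u else Suc u) = row_label I \<alpha> r d k u" for u
    proof (cases "u < k + d")
      case True
      \<comment> \<open>The index newly retained at \<open>Suc k\<close> is the first middle index
        at \<open>k\<close>.\<close>
      then show ?thesis using assms(2) by (cases "u = k") (simp_all add: row_label_def less_Suc_eq)
    next
      case False
      then obtain l where "u = k + d + l" by (metis le_iff_add not_less)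
      then show ?thesis by (simp add: row_label_def label_def)
    qed
    show ?thesis
      unfolding full_mat_def mat_delete_def
      by (rule eq_matI) (simp_all add: del_col del_row)
  qed
  finally show ?thesis
    by (simp add: power_add mult.commute[of "(-1) ^ k"] mult.assoc flip: power_mult_distrib)
qed

section \<open>Labels of the retained rows and columns\<close>

text \<open>The positions with value at most \<open>k + card B\<close> form an initial segment, and
  there are \<open>k\<close> of them by counting.\<close>

lemma enumerate_complement:
  assumes "B \<subseteq> {1..k + card B}"
  shows "bij_betw (enumerate ({1..} - B)) {..<k} ({1..k + card B} - B)"
proof -
  let ?S = "{1..} - B" and ?m = "k + card B"
  let ?e = "enumerate ?S"
  have "finite B" using assms by (rule finite_subset) simp
  then have inf: "infinite ?S" by (simp add: infinite_Ici)
  define V where "V = {u. ?e u \<le> ?m}"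
  have im: "?e ` V = {1..?m} - B"
  proof
    show "?e ` V \<subseteq> {1..?m} - B"
      using enumerate_in_set[OF inf] by (auto simp: V_def)
    show "{1..?m} - B \<subseteq> ?e ` V"
    proof
      fix a assume a: "a \<in> {1..?m} - B"
      then have "a \<in> range ?e" unfolding range_enumerate[OF inf] by simp
      then obtain u where "a = ?e u" by blast
      with a show "a \<in> ?e ` V" by (simp add: V_def)
    qed
  qed
  have inj: "inj ?e" by (rule inj_enumerate[OF inf])
  have "card V = card ({1..?m} - B)"
    unfolding im[symmetric] by (rule card_image[symmetric]) (rule inj_on_subset[OF inj subset_UNIV])
  also have "\<dots> = k"
    using assms by (simp add: card_Diff_subset \<open>finite B\<close>)
  finally have "card V = k" .
  have "finite V"
    using im inj by (metis finite_Diff finite_atLeastAtMost finite_imageD inj_on_subset subset_UNIV)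
  have down: "u \<in> V" if "v \<in> V" "u \<le> v" for u v
    using that enumerate_mono_le_iff[OF inf, of u v] le_trans[of "?e u" "?e v" ?m]
    unfolding V_def by blast
  have "V \<subseteq> {..<k}"
  proof
    fix v assume "v \<in> V"
    then have "{..v} \<subseteq> V" using down by auto
    from card_mono[OF \<open>finite V\<close> this] show "v \<in> {..<k}" using \<open>card V = k\<close> by auto
  qed
  then have "V = {..<k}"
    using \<open>card V = k\<close> by (intro card_subset_eq) auto
  then show ?thesis
    using im inj by (auto simp: bij_betw_def intro: inj_on_subset)
qed

lemma enumerate_complement_Suc:
  assumes "B \<subseteq> {1..k + card B}"
  shows "enumerate ({1..} - B) k = k + card B + 1"
proof -
  let ?e = "enumerate ({1..} - B)"
  have *: "B \<subseteq> {1..Suc k + card B}" using assms by fastforce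
  have "?e k \<in> {1..Suc k + card B} - B"
    using bij_betwE[OF enumerate_complement[OF *]] by auto
  moreover have "?e k \<notin> {1..k + card B} - B"
  proof
    assume "?e k \<in> {1..k + card B} - B"
    then have "?e k \<in> ?e ` {..<k}"
      using enumerate_complement[OF assms] by (simp add: bij_betw_def)
    then obtain u where "u < k" "?e u = ?e k" by auto
    then show False
      using enumerate_complement[OF *] by (auto simp: bij_betw_def dest: inj_onD[where x = u and y = k])
  qed
  ultimately show ?thesis by auto
qed

text \<open>The retained labels fill the complement of the deleted ones. Here the lower bound on
  \<open>j\<close> takes effect: all deletions lie in \<open>{1..k + c}\<close>.\<close>

lemma bij_betw_label:
  assumes "inj_on \<beta> {1..c}" "\<beta> ` {1..c} \<subseteq> {1..k + c}"
  shows "bij_betw (label (enumerate ({1..} - \<beta> ` {1..c})) \<beta> k) {..<k + c} {1..k + c}"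
proof -
  let ?B = "\<beta> ` {1..c}"
  let ?l = "label (enumerate ({1..} - ?B)) \<beta> k"
  have card: "card ?B = c" using assms(1) by (simp add: card_image)
  have "bij_betw ?l {..<k} ({1..k + c} - ?B)"
    using enumerate_complement[of ?B k] assms(2) unfolding card
    by (subst bij_betw_cong[of _ _ "enumerate ({1..} - ?B)"]) (simp_all add: label_def)
  moreover have "bij_betw ?l {k..<k + c} ?B"
  proof -
    have "bij_betw (\<lambda>u. u - k + 1) {k..<k + c} {1..c}"
      by (rule bij_betw_byWitness[where f' = "\<lambda>i. i + k - 1"]) auto
    moreover have "bij_betw \<beta> {1..c} ?B" using assms(1) by (simp add: bij_betw_def)
    ultimately have "bij_betw (\<beta> \<circ> (\<lambda>u. u - k + 1)) {k..<k + c} ?B" by (rule bij_betw_trans)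
    then show ?thesis by (subst bij_betw_cong) (auto simp: label_def)
  qed
  ultimately have "bij_betw ?l ({..<k} \<union> {k..<k + c}) (({1..k + c} - ?B) \<union> ?B)"
    by (rule bij_betw_combine) auto
  moreover have "{..<k} \<union> {k..<k + c} = {..<k + c}" by auto
  moreover have "({1..k + c} - ?B) \<union> ?B = {1..k + c}" using assms(2) by auto
  ultimately show ?thesis by simp
qed

section \<open>Assembling the recurrence\<close>

theorem minor_recurrence:
  fixes x :: "nat \<Rightarrow> 'a::comm_ring_1"
  assumes "r \<le> c" "c \<le> n"
    and \<alpha>: "strict_mono_on {1..r} \<alpha>" "\<forall>i\<in>{1..r}. \<alpha> i \<ge> 1"
    and \<beta>: "strict_mono_on {1..c} \<beta>" "\<forall>i\<in>{1..c}. \<beta> i \<ge> 1"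
    and \<alpha>_le: "\<forall>i\<in>{1..r}. \<alpha> i \<le> j + r" and \<beta>_le: "\<forall>i\<in>{1..c}. \<beta> i \<le> j + c"
  shows "shift_act (subset_prod_poly n x (c - r)) (\<lambda>t. det (D_mat n x r \<alpha> c \<beta> (j + t))) 0 = 0"
proof -
  define d where "d = c - r"
  have c: "c = d + r" and "d \<le> n"
    using assms(1,2) by (auto simp: d_def)
  define I where "I = enumerate ({1..} - \<alpha> ` {1..r})"
  define J where "J = enumerate ({1..} - \<beta> ` {1..c})"
  define z where "z m i = fps_int_nth (hom_fps x i) m" for m i
  \<comment> \<open>The term \<open>int n - int i\<close> is the position of the row with
    \<open>i\<close> variables, so one \<open>g\<close> serves all moving rows and losing a variable
    balances a shift of \<open>t\<close>.\<close>
  define g where "g i t p = z (int (j + r + t) + 1 - int (\<beta> (p + 1)) + int n - int i) i" for i t p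
  define C where "C i p = z (int (\<alpha> (i - d + 1)) - int (\<beta> (p + 1))) n" for i p
  define K where "K t = det (full_mat (elem_fps x n) (row_label I \<alpha> r d (j + t)) (label J \<beta> (j + t)) (j + t + (d + r)))" for t
  define q :: 'a where "q = (- 1) ^ d"
  let ?T = "{\<sigma>. \<sigma> \<subseteq> {1..n} \<and> card \<sigma> = d}"
  have inj: "inj_on \<alpha> {1..r}" "inj_on \<beta> {1..c}"
    using \<alpha>(1) \<beta>(1) by (auto intro: strict_mono_on_imp_inj_on)
  have sub: "\<alpha> ` {1..r} \<subseteq> {1..j + t + r}" "\<beta> ` {1..c} \<subseteq> {1..j + t + c}" for t
    using \<alpha>(2) \<alpha>_le \<beta>(2) \<beta>_le by fastforce+
  have card: "card (\<alpha> ` {1..r}) = r" "card (\<beta> ` {1..c}) = c"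
    using inj by (simp_all add: card_image)
  have cols: "bij_betw (label J \<beta> (j + t)) {..<j + t + (d + r)} {1..j + t + (d + r)}" for t
    using bij_betw_label[OF inj(2) sub(2)[of t]] by (simp add: J_def c)
  have K_Suc: "K (Suc t) = q * K t" for t
  proof -
    have "I (j + t) = j + t + r + 1" "J (j + t) = j + t + (d + r) + 1"
      using enumerate_complement_Suc[of "\<alpha> ` {1..r}" "j + t"] enumerate_complement_Suc[of "\<beta> ` {1..c}" "j + t"]
        sub[of t] unfolding card I_def J_def by (simp_all add: c)
    moreover have "fps_nth (elem_fps x n) 0 = 1"
      using elem_fps_mult_hom_fps_nth(1)[of x 0 n] by simp
    ultimately show ?thesis
      using det_full_mat_Suc[of J \<beta> "j + t" d r I "elem_fps x n" \<alpha>] cols[of "Suc t"]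
      by (simp add: K_def q_def)
  qed
  have K: "K t = q ^ t * K 0" for t
    by (induction t) (simp_all add: K_Suc mult.assoc)
  have minor: "det (D_mat n x r \<alpha> c \<beta> (j + t)) = K 0 * (q ^ t * row_det g C c d (\<lambda>i. n - i) t)" for t
  proof -
    let ?k = "j + t"
    let ?W = "mat (d + r) (d + r) (\<lambda>(p, w). fps_int_nth (if w < d then hom_fps x (n - w) else hom_fps x n)
          (int (row_label I \<alpha> r d ?k (?k + w)) - int (\<beta> (p + 1))))"
    have D: "D_mat n x r \<alpha> c \<beta> ?k = mat ?k ?k (\<lambda>(u, v). fps_int_nth (elem_fps x n) (int (J v) - int (I u)))"
      by (simp add: D_mat_def A_mat_def s_sym_eq I_def J_def)
    have "det (D_mat n x r \<alpha> c \<beta> ?k) = K t * det ?W"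
      unfolding K_def D
    proof (rule det_minor_eq)
      show "bij_betw (label I \<alpha> ?k) {..<?k + r} {1..?k + r}"
        using bij_betw_label[OF inj(1) sub(1)[of t]] by (simp add: I_def)
      fix i assume "i < d"
      then have n: "n = n - i + i" using \<open>d \<le> n\<close> by simp
      show "fps_nth (elem_fps x n * hom_fps x (n - i)) 0 = 1"
        by (subst (1) n) (rule elem_fps_mult_hom_fps_nth(1))
      show "fps_nth (elem_fps x n * hom_fps x (n - i)) m = 0" if "i < m" for m
        by (subst (1) n) (rule elem_fps_mult_hom_fps_nth(2)[OF that])
    qed (use cols elem_fps_mult_hom_fps in auto)
    \<comment> \<open>Transposition turns the moving columns into the rows of
      \<open>row_det\<close>.\<close>
    moreover have "det ?W = det ?W\<^sup>T"
      by (rule det_transpose[symmetric, where n = "d + r"]) simp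
    moreover have "?W\<^sup>T = mat c c (\<lambda>(i, p). if i < d then g (n - i) t p else C i p)"
    proof (rule eq_matI)
      fix i p assume "i < dim_row (mat c c (\<lambda>(i, p). if i < d then g (n - i) t p else C i p))"
        "p < dim_col (mat c c (\<lambda>(i, p). if i < d then g (n - i) t p else C i p))"
      then have *: "i < d + r" "p < d + r" by (auto simp: c)
      have entry: "fps_int_nth (if i < d then hom_fps x (n - i) else hom_fps x n)
          (int (row_label I \<alpha> r d ?k (?k + i)) - int (\<beta> (p + 1))) = (if i < d then g (n - i) t p else C i p)"
      proof (cases "i < d")
        case True
        then have "int (row_label I \<alpha> r d ?k (?k + i)) - int (\<beta> (p + 1))
            = int (j + r + t) + 1 - int (\<beta> (p + 1)) + int n - int (n - i)"
          using \<open>d \<le> n\<close> by (simp add: row_label_def of_nat_diff)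
        with True show ?thesis by (simp only: g_def z_def if_True)
      next
        case False
        then obtain l where "i = d + l" by (metis le_iff_add not_less)
        then have "row_label I \<alpha> r d ?k (?k + i) = \<alpha> (i - d + 1)"
          by (simp add: row_label_def label_def)
        with False show ?thesis by (simp only: C_def z_def if_False)
      qed
      show "?W\<^sup>T $$ (i, p) = mat c c (\<lambda>(i, p). if i < d then g (n - i) t p else C i p) $$ (i, p)"
        using * entry by (simp add: c)
    qed (simp_all add: c)
    ultimately show ?thesis
      by (simp only: K[of t] row_det_def mult.assoc mult.left_commute[of "K 0"])
  qed
  \<comment> \<open>The signs built into \<open>hom_fps\<close> replace \<open>x i\<close> by
    \<open>- x i\<close> in the recurrence.\<close>
  have vanish: "shift_act (\<Prod>\<sigma>\<in>?T. [:- (\<Prod>i\<in>\<sigma>. - x i), 1:]) (row_det g C c d (\<lambda>i. n - i)) = (\<lambda>_. 0)"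
  proof (rule shift_act_row_det_eq_0[where n = n])
    fix i p t :: nat assume "1 \<le> i"
    show "g i (Suc t) p = - x i * g i t p + g (i - 1) t p"
    proof -
      let ?m = "int (j + r + t) + 1 - int (\<beta> (p + 1)) + int n - int i"
      have "g i (Suc t) p = z (?m + 1) i" "g i t p = z ?m i" "g (i - 1) t p = z (?m + 1) (i - 1)"
        using \<open>1 \<le> i\<close> by (simp_all add: g_def of_nat_diff algebra_simps)
      then show ?thesis
        unfolding z_def by (simp only: hom_fps_rec[OF \<open>1 \<le> i\<close>])
    qed
  next
    fix p t :: nat assume "p < c"
    then have "\<beta> (p + 1) \<le> j + c" using \<beta>_le by simp
    \<comment> \<open>Without variables only degree 0 survives, but the degree here is at least
      \<open>n - d + 1 + t\<close>.\<close>
    then show "g 0 t p = 0"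
      using \<open>d \<le> n\<close> by (auto simp: g_def z_def fps_int_nth_def c)
  qed (auto simp: c)
  \<comment> \<open>The sign of a \<open>d\<close>-fold product equals the factor \<open>q\<close>
    gained by \<open>K\<close> per step, so \<open>shift_act_twist\<close> removes both.\<close>
  have "(\<Prod>i\<in>\<sigma>. x i) = q * (\<Prod>i\<in>\<sigma>. - x i)" if "\<sigma> \<in> ?T" for \<sigma>
    using that by (simp add: prod_uminus q_def flip: mult.assoc power_mult_distrib)
  then have poly: "subset_prod_poly n x d = (\<Prod>\<sigma>\<in>?T. [:- (q * (\<Prod>i\<in>\<sigma>. - x i)), 1:])"
    unfolding subset_prod_poly_def by (intro prod.cong) auto
  have "finite ?T"
    by (rule finite_subset[of _ "Pow {1..n}"]) auto
  then show ?thesis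
    unfolding d_def[symmetric] minor poly shift_act_mult_left
      shift_act_twist[OF \<open>finite ?T\<close>] vanish
    by simp
qed

theorem theorem3:
  fixes n r c b j :: nat and \<alpha> \<beta> :: "nat \<Rightarrow> nat"
    and x :: "nat \<Rightarrow> 'a::comm_ring_1 mpolynomial"
  defines "x \<equiv> indet"
  defines "b \<equiv> n choose (c - r)"
  assumes "n \<ge> 1" and "r \<le> c" and "c \<le> n"
    and "strict_mono_on {1..r} \<alpha>" and "\<forall>i\<in>{1..r}. \<alpha> i \<ge> 1"
    and "strict_mono_on {1..c} \<beta>" and "\<forall>i\<in>{1..c}. \<beta> i \<ge> 1"
    and "\<forall>i\<in>{1..r}. \<alpha> i \<ge> \<beta> i"
    and "r \<ge> 1 \<longrightarrow> int j \<ge> int (\<alpha> r) - int r"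
    and "c \<ge> 1 \<longrightarrow> int j \<ge> int (\<beta> c) - int c"
  shows "(\<Sum>k=0..b. Q_poly n x (c - r) (b - k) * det (D_mat n x r \<alpha> c \<beta> (k + j))) = 0"
proof -
  \<comment> \<open>Monotonicity spreads the bound at the last entry to all entries.\<close>
  have le: "f i \<le> j + m" if "strict_mono_on {1..m} f" "m \<ge> 1 \<longrightarrow> int j \<ge> int (f m) - int m" "i \<in> {1..m}"
    for f :: "nat \<Rightarrow> nat" and m i
  proof -
    have "f i \<le> f m"
      using that by (cases "i = m") (auto dest: strict_mono_onD[where r = i and s = m])
    then show ?thesis using that by auto
  qed
  have "(\<Sum>k=0..b. Q_poly n x (c - r) (b - k) * det (D_mat n x r \<alpha> c \<beta> (k + j)))
      = (\<Sum>k\<le>b. coeff (subset_prod_poly n x (c - r)) k * det (D_mat n x r \<alpha> c \<beta> (j + k)))"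
    by (rule sum.cong) (auto simp: Q_poly_def b_def add.commute[of j])
  also have "\<dots> = shift_act (subset_prod_poly n x (c - r)) (\<lambda>t. det (D_mat n x r \<alpha> c \<beta> (j + t))) 0"
    unfolding b_def by (subst shift_act_altdef[OF degree_subset_prod_poly]) simp
  also have "\<dots> = 0"
  proof (rule minor_recurrence)
    show "\<forall>i\<in>{1..r}. \<alpha> i \<le> j + r"
      by (intro ballI le) (use assms in auto)
    show "\<forall>i\<in>{1..c}. \<beta> i \<le> j + c"
      by (intro ballI le) (use assms in auto)
  qed (use assms in auto)
  finally show ?thesis .
qed

end
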